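(* Let $\{f_k(x)\}_{k\in\mathbb Z_{\ge0}}$ be a sequence of polynomials with complex coefficients such that $f_0(x)=1$ and $f_k(0)=0$ for all $k\ge1$. For a partition $\lambda=(\lambda_1\ge\dots\ge\lambda_l>0)$ and $n\ge l$, set $\lambda_{l+1}=\dots=\lambda_n=0$ and $$\tilde{\tilde F}_\lambda(x_1,\dots,x_n;t)=\frac{(1-t)^n}{\prod_{i=1}^{n-l}(1-t^i)}\sum_{\sigma\in S_n}\sigma\left(f_{\lambda_1}(x_1)\cdots f_{\lambda_n}(x_n)\prod_{1\le i<j\le n}\frac{x_i-tx_j}{x_i-x_j}\right).$$ Then this family of symmetric polynomials in $(x_1,\dots,x_n)$ satisfies the stability property $$\tilde{\tilde F}_\lambda(x_1,\dots,x_n;t)=\tilde{\tilde F}_\lambda(x_1,\dots,x_n,0;t).$$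
   Context: $t$ is an indeterminate; $S_n$ acts on rational functions by permuting $x_1,\dots,x_n$. The right-hand side of the stability property is the $(n+1)$-variable polynomial evaluated at $x_{n+1}=0$. *)

theory Defs
  imports
    "HOL-Library.Poly_Mapping"
    "HOL-Computational_Algebra.Computational_Algebra"
    "HOL-Combinatorics.Permutations"
begin

section \<open>Polynomials and rational functions in x_1, x_2, ... over C(t)\<close>

type_synonym ct = "complex poly fract"

text \<open>
  All numbers of variables live in one ring: a monomial is a finitely supported map from
  indices to exponents, and being a polynomial in x_1, ..., x_n is a condition on the
  occurring indices. Only indices from 1 on are used. The monomial order behind the
  integral domain instance is the library's lexicographic one.
\<close>

type_synonym mpol = "(nat \<Rightarrow>\<^sub>0 nat) \<Rightarrow>\<^sub>0 ct"
type_synonym ratfun = "mpol fract"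

definition mconst :: "ct \<Rightarrow> mpol" where
  "mconst c = Poly_Mapping.single 0 c"

definition X :: "nat \<Rightarrow> mpol" where
  "X i = Poly_Mapping.single (Poly_Mapping.single i 1) 1"

definition tvar :: mpol where
  "tvar = mconst (to_fract [:0, 1:])"

definition mvars :: "mpol \<Rightarrow> nat set" where
  "mvars P = (\<Union>m\<in>Poly_Mapping.keys P. Poly_Mapping.keys m)"

text \<open>Substitution of s i for x_i, for all i simultaneously; coefficients are kept.\<close>

definition msubst :: "(nat \<Rightarrow> mpol) \<Rightarrow> mpol \<Rightarrow> mpol" where
  "msubst s P = (\<Sum>m\<in>Poly_Mapping.keys P. mconst (Poly_Mapping.lookup P m) *
     (\<Prod>i\<in>Poly_Mapping.keys m. s i ^ Poly_Mapping.lookup m i))"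

definition mpermute :: "(nat \<Rightarrow> nat) \<Rightarrow> mpol \<Rightarrow> mpol" where
  "mpermute \<sigma> = msubst (\<lambda>i. X (\<sigma> i))"

definition msubst_zero :: "nat \<Rightarrow> mpol \<Rightarrow> mpol" where
  "msubst_zero k = msubst (X(k := 0))"

text \<open>
  A representing quotient is chosen here; for bijective \<open>\<sigma>\<close> the result does not depend on
  the choice, see \<open>rpermute_Fract\<close> below.
\<close>

definition rpermute :: "(nat \<Rightarrow> nat) \<Rightarrow> ratfun \<Rightarrow> ratfun" where
  "rpermute \<sigma> r = (case (SOME pq. snd pq \<noteq> 0 \<and> r = Fract (fst pq) (snd pq)) of
     (p, q) \<Rightarrow> Fract (mpermute \<sigma> p) (mpermute \<sigma> q))"

definition symmetric_mpol :: "nat \<Rightarrow> mpol \<Rightarrow> bool" where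
  "symmetric_mpol n P \<longleftrightarrow>
     mvars P \<subseteq> {1..n} \<and> (\<forall>\<sigma>. \<sigma> permutes {1..n} \<longrightarrow> mpermute \<sigma> P = P)"


section \<open>The symmetric functions\<close>

definition is_partition :: "nat list \<Rightarrow> bool" where
  "is_partition lam \<longleftrightarrow> sorted_wrt (\<ge>) lam \<and> (\<forall>k\<in>set lam. k > 0)"

text \<open>The i-th part for i = 1, 2, ..., padded by zeros.\<close>

definition part :: "nat list \<Rightarrow> nat \<Rightarrow> nat" where
  "part lam i = (if 1 \<le> i \<and> i \<le> length lam then lam ! (i - 1) else 0)"

definition apply_at :: "complex poly \<Rightarrow> nat \<Rightarrow> mpol" where
  "apply_at p i = poly (map_poly (\<lambda>c. mconst (to_fract [:c:])) p) (X i)"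

definition Ftt :: "(nat \<Rightarrow> complex poly) \<Rightarrow> nat list \<Rightarrow> nat \<Rightarrow> ratfun" where
  "Ftt f lam n =
     (let t = to_fract tvar; x = (\<lambda>i. to_fract (X i)) in
       (1 - t) ^ n / (\<Prod>i\<in>{1..n - length lam}. 1 - t ^ i) *
       (\<Sum>\<sigma> | \<sigma> permutes {1..n}. rpermute \<sigma>
          ((\<Prod>i\<in>{1..n}. to_fract (apply_at (f (part lam i)) i)) *
           (\<Prod>(i, j)\<in>{(i, j). 1 \<le> i \<and> i < j \<and> j \<le> n}. (x i - t * x j) / (x i - x j)))))"


section \<open>Basic facts: substitution is a ring homomorphism\<close>

lemma mconst_0 [simp]: "mconst 0 = 0" and mconst_1 [simp]: "mconst 1 = 1"
  by (simp_all add: mconst_def)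

lemma mconst_add: "mconst (a + b) = mconst a + mconst b"
  by (simp add: mconst_def single_add)

lemma mconst_mult: "mconst (a * b) = mconst a * mconst b"
  by (simp add: mconst_def mult_single)

definition msubst_mon :: "(nat \<Rightarrow> mpol) \<Rightarrow> (nat \<Rightarrow>\<^sub>0 nat) \<Rightarrow> mpol" where
  "msubst_mon s m = (\<Prod>i\<in>Poly_Mapping.keys m. s i ^ Poly_Mapping.lookup m i)"

lemma msubst_mon_superset:
  assumes "finite A" "Poly_Mapping.keys m \<subseteq> A"
  shows "msubst_mon s m = (\<Prod>i\<in>A. s i ^ Poly_Mapping.lookup m i)"
  unfolding msubst_mon_def
  by (rule prod.mono_neutral_left) (use assms in \<open>auto simp: in_keys_iff\<close>)

lemma msubst_mon_add: "msubst_mon s (m + m') = msubst_mon s m * msubst_mon s m'"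
proof -
  let ?A = "Poly_Mapping.keys m \<union> Poly_Mapping.keys m'"
  have "Poly_Mapping.keys (m + m') \<subseteq> ?A"
    by (rule Poly_Mapping.keys_add)
  then show ?thesis
    by (simp add: msubst_mon_superset[where A = ?A] lookup_add power_add prod.distrib)
qed

lemma msubst_superset:
  assumes "finite A" "Poly_Mapping.keys P \<subseteq> A"
  shows "msubst s P = (\<Sum>m\<in>A. mconst (Poly_Mapping.lookup P m) * msubst_mon s m)"
  unfolding msubst_def msubst_mon_def[symmetric]
  by (rule sum.mono_neutral_left) (use assms in \<open>auto simp: in_keys_iff\<close>)

lemma msubst_add: "msubst s (P + Q) = msubst s P + msubst s Q"
proof -
  let ?A = "Poly_Mapping.keys P \<union> Poly_Mapping.keys Q"
  have "Poly_Mapping.keys (P + Q) \<subseteq> ?A"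
    by (rule Poly_Mapping.keys_add)
  then show ?thesis
    by (simp add: msubst_superset[where A = ?A] lookup_add mconst_add distrib_right sum.distrib)
qed

lemma msubst_0 [simp]: "msubst s 0 = 0"
  by (simp add: msubst_def)

lemma msubst_single: "msubst s (Poly_Mapping.single m c) = mconst c * msubst_mon s m"
  by (subst msubst_superset[where A = "{m}"]) auto

lemma msubst_sum: "msubst s (sum g A) = (\<Sum>a\<in>A. msubst s (g a))"
  by (induction A rule: infinite_finite_induct) (auto simp: msubst_add)

lemma mpol_expand:
  "(P :: mpol) = (\<Sum>m\<in>Poly_Mapping.keys P. Poly_Mapping.single m (Poly_Mapping.lookup P m))"
  by (rule poly_mapping_eqI)
     (auto simp: lookup_sum lookup_single when_def in_keys_iff sum.delta)

lemma msubst_mult: "msubst s (P * Q) = msubst s P * msubst s Q"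
proof -
  let ?l = "Poly_Mapping.lookup" and ?k = "Poly_Mapping.keys"
  have "P * Q = (\<Sum>m\<in>?k P. \<Sum>m'\<in>?k Q. Poly_Mapping.single (m + m') (?l P m * ?l Q m'))"
    by (subst mpol_expand[of P], subst mpol_expand[of Q])
       (simp add: sum_product mult_single)
  then have "msubst s (P * Q) = (\<Sum>m\<in>?k P. \<Sum>m'\<in>?k Q.
      (mconst (?l P m) * msubst_mon s m) * (mconst (?l Q m') * msubst_mon s m'))"
    by (simp add: msubst_sum msubst_single msubst_mon_add mconst_mult ac_simps)
  also have "\<dots> = msubst s P * msubst s Q"
    by (simp add: sum_product msubst_def msubst_mon_def)
  finally show ?thesis .
qed

lemma msubst_mconst [simp]: "msubst s (mconst c) = mconst c"
  by (simp add: mconst_def msubst_single msubst_mon_def mult_single)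

lemma msubst_1 [simp]: "msubst s 1 = 1"
  using msubst_mconst[of s 1] by simp

lemma msubst_X [simp]: "msubst s (X i) = s i"
  by (simp add: X_def msubst_single msubst_mon_def)

lemma msubst_power: "msubst s (P ^ k) = msubst s P ^ k"
  by (induction k) (auto simp: msubst_mult)

lemma msubst_prod: "msubst s (prod g A) = (\<Prod>a\<in>A. msubst s (g a))"
  by (induction A rule: infinite_finite_induct) (auto simp: msubst_mult)

lemma msubst_msubst: "msubst s (msubst r P) = msubst (\<lambda>i. msubst s (r i)) P"
  by (simp add: msubst_def[of r P] msubst_def[of _ P] msubst_sum msubst_mult msubst_prod
      msubst_power)

lemma X_power: "X i ^ k = Poly_Mapping.single (Poly_Mapping.single i k) 1"
  by (induction k) (simp_all add: X_def mult_single single_add[symmetric])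

lemma prod_X_single:
  "(\<Prod>i\<in>A. Poly_Mapping.single (g i) (1::ct)) = Poly_Mapping.single (\<Sum>i\<in>A. g i) 1"
  by (induction A rule: infinite_finite_induct) (auto simp: mult_single)

lemma msubst_mon_X: "msubst_mon X m = Poly_Mapping.single m 1"
proof -
  have "(\<Sum>i\<in>Poly_Mapping.keys m. Poly_Mapping.single i (Poly_Mapping.lookup m i)) = m"
    by (rule poly_mapping_eqI)
       (auto simp: lookup_sum lookup_single when_def in_keys_iff sum.delta)
  then show ?thesis
    by (simp add: msubst_mon_def X_power prod_X_single)
qed

lemma msubst_id [simp]: "msubst X P = P"
  unfolding msubst_def msubst_mon_def[symmetric] msubst_mon_X
  by (simp add: mconst_def mult_single flip: mpol_expand)

lemma mpermute_eq_0_iff: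
  assumes "bij \<sigma>"
  shows "mpermute \<sigma> P = 0 \<longleftrightarrow> P = 0"
proof -
  have "mpermute (inv \<sigma>) (mpermute \<sigma> P) = msubst X P"
    using assms by (simp add: mpermute_def msubst_msubst bij_is_inj)
  then show ?thesis
    by (auto simp: mpermute_def)
qed

lemma rpermute_Fract:
  assumes "bij \<sigma>" "q \<noteq> 0"
  shows "rpermute \<sigma> (Fract p q) = Fract (mpermute \<sigma> p) (mpermute \<sigma> q)"
proof -
  define ab where "ab = (SOME pq. snd pq \<noteq> 0 \<and> Fract p q = Fract (fst pq) (snd pq))"
  have ab: "snd ab \<noteq> 0 \<and> Fract p q = Fract (fst ab) (snd ab)"
    unfolding ab_def by (rule someI[of _ "(p, q)"]) (use assms in auto)
  then have "p * snd ab = fst ab * q"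
    using eq_fract(1)[of q "snd ab" p "fst ab"] assms by blast
  then have "mpermute \<sigma> p * mpermute \<sigma> (snd ab) = mpermute \<sigma> (fst ab) * mpermute \<sigma> q"
    unfolding mpermute_def by (metis msubst_mult)
  moreover have "mpermute \<sigma> (snd ab) \<noteq> 0" "mpermute \<sigma> q \<noteq> 0"
    using ab assms by (auto simp: mpermute_eq_0_iff)
  ultimately show ?thesis
    unfolding rpermute_def ab_def[symmetric] by (simp add: case_prod_beta eq_fract(1))
qed

end

theory Submission
  imports Defs
begin

text \<open>
  Polynomiality: after multiplication by the Vandermonde product \<open>\<Delta>\<close>, the symmetric sum
  \<open>S\<close> becomes a polynomial \<open>N\<close> that vanishes under x_a = x_b for all a < b, so \<open>\<Delta>\<close>
  divides \<open>N\<close>.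

  Stability: put x_(n+1) = 0 in the summand of a permutation \<open>\<sigma>\<close> of n + 1 with
  \<open>\<sigma>(k) = n + 1\<close>. If k is at most the length l of the partition, the factor f at x_(n+1)
  kills the summand. Otherwise each of the n + 1 - k pairs (k, j) contributes a factor t, each
  pair (i, k) a factor 1, and what remains is the summand in n variables of \<open>\<sigma>\<close> with its
  k-th value removed. So the sum is multiplied by 1 + t + ... + t^(n-l), which the
  normalizing factor compensates.
\<close>

section \<open>Specialization of rational functions\<close>

text \<open>
  Substitution is only partially defined on rational functions: some representing quotient
  must keep a nonzero denominator. Permuting variables, setting the variables outside a set to
  zero and setting x_(n+1) = 0 are all instances.
\<close>

definition specializes :: "(nat \<Rightarrow> mpol) \<Rightarrow> ratfun \<Rightarrow> ratfun \<Rightarrow> bool" where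
  "specializes s r r' \<longleftrightarrow>
     (\<exists>p q. msubst s q \<noteq> 0 \<and> r = Fract p q \<and> r' = Fract (msubst s p) (msubst s q))"

lemma specializesI:
  "msubst s q \<noteq> 0 \<Longrightarrow> r = Fract p q \<Longrightarrow> r' = Fract (msubst s p) (msubst s q) \<Longrightarrow> specializes s r r'"
  by (auto simp: specializes_def)

lemma specializesE:
  assumes "specializes s r r'"
  obtains p q where "q \<noteq> 0" "msubst s q \<noteq> 0" "r = Fract p q" "r' = Fract (msubst s p) (msubst s q)"
  using assms by (auto simp: specializes_def) (metis msubst_0)

lemma specializes_to_fract: "specializes s (to_fract p) (to_fract (msubst s p))"
  by (rule specializesI[of s 1 _ p]) (simp_all add: to_fract_def)

text \<open>Two representing quotients agree up to cross-multiplication, which the ring homomorphism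
  \<open>msubst s\<close> preserves. Later identities come from specializing one function in two
  ways.\<close>

lemma specializes_unique:
  assumes "specializes s r a" "specializes s r b"
  shows "a = b"
proof -
  obtain p q where 1: "q \<noteq> 0" "msubst s q \<noteq> 0" "r = Fract p q" "a = Fract (msubst s p) (msubst s q)"
    using assms(1) by (rule specializesE)
  obtain p' q' where 2: "q' \<noteq> 0" "msubst s q' \<noteq> 0" "r = Fract p' q'" "b = Fract (msubst s p') (msubst s q')"
    using assms(2) by (rule specializesE)
  have "p * q' = p' * q"
    using 1 2 eq_fract(1)[of q q' p p'] by auto
  then have "msubst s p * msubst s q' = msubst s p' * msubst s q"
    by (metis msubst_mult)
  then show ?thesis
    using 1 2 by (simp add: eq_fract(1))
qed

lemma specializes_add:
  assumes "specializes s a a'" "specializes s b b'"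
  shows "specializes s (a + b) (a' + b')"
proof -
  obtain p q where 1: "q \<noteq> 0" "msubst s q \<noteq> 0" "a = Fract p q" "a' = Fract (msubst s p) (msubst s q)"
    using assms(1) by (rule specializesE)
  obtain p' q' where 2: "q' \<noteq> 0" "msubst s q' \<noteq> 0" "b = Fract p' q'" "b' = Fract (msubst s p') (msubst s q')"
    using assms(2) by (rule specializesE)
  show ?thesis
    by (rule specializesI[of s "q * q'" _ "p * q' + p' * q"])
       (use 1 2 in \<open>simp_all add: msubst_add msubst_mult\<close>)
qed

lemma specializes_mult:
  assumes "specializes s a a'" "specializes s b b'"
  shows "specializes s (a * b) (a' * b')"
proof -
  obtain p q where 1: "q \<noteq> 0" "msubst s q \<noteq> 0" "a = Fract p q" "a' = Fract (msubst s p) (msubst s q)"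
    using assms(1) by (rule specializesE)
  obtain p' q' where 2: "q' \<noteq> 0" "msubst s q' \<noteq> 0" "b = Fract p' q'" "b' = Fract (msubst s p') (msubst s q')"
    using assms(2) by (rule specializesE)
  show ?thesis
    by (rule specializesI[of s "q * q'" _ "p * p'"])
       (use 1 2 in \<open>simp_all add: msubst_mult\<close>)
qed

lemma specializes_divide:
  assumes "specializes s a a'" "specializes s b b'" "b' \<noteq> 0"
  shows "specializes s (a / b) (a' / b')"
proof -
  obtain p q where 1: "q \<noteq> 0" "msubst s q \<noteq> 0" "a = Fract p q" "a' = Fract (msubst s p) (msubst s q)"
    using assms(1) by (rule specializesE)
  obtain p' q' where 2: "q' \<noteq> 0" "msubst s q' \<noteq> 0" "b = Fract p' q'" "b' = Fract (msubst s p') (msubst s q')"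
    using assms(2) by (rule specializesE)
  \<comment> \<open>The numerator of the divisor becomes a denominator, so its image must not
    vanish.\<close>
  have "msubst s p' \<noteq> 0"
    using 2 assms(3) by (auto simp: fract_collapse)
  then show ?thesis
    by (intro specializesI[of s "q * p'" _ "p * q'"])
       (use 1 2 in \<open>simp_all add: msubst_mult\<close>)
qed

lemma specializes_divide_to_fract:
  "msubst s q \<noteq> 0 \<Longrightarrow>
     specializes s (to_fract p / to_fract q) (to_fract (msubst s p) / to_fract (msubst s q))"
  by (intro specializes_divide specializes_to_fract) simp

lemma specializes_sum:
  assumes "\<And>a. a \<in> A \<Longrightarrow> specializes s (g a) (g' a)"
  shows "specializes s (sum g A) (sum g' A)"
  using assms
proof (induction A rule: infinite_finite_induct)
  case (insert a A)
  then show ?case by (auto intro: specializes_add)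
qed (use specializes_to_fract[of s 0] in auto)

lemma specializes_prod:
  assumes "\<And>a. a \<in> A \<Longrightarrow> specializes s (g a) (g' a)"
  shows "specializes s (prod g A) (prod g' A)"
  using assms
proof (induction A rule: infinite_finite_induct)
  case (insert a A)
  then show ?case by (auto intro: specializes_mult)
qed (use specializes_to_fract[of s 1] in auto)

text \<open>Renaming variables bijectively is injective on polynomials, so any quotient can serve as
  representative.\<close>

lemma specializes_rpermute:
  assumes "bij \<sigma>"
  shows "specializes (\<lambda>i. X (\<sigma> i)) r (rpermute \<sigma> r)"
proof -
  obtain p q where "r = Fract p q" "q \<noteq> 0"
    by (cases r) auto
  with assms show ?thesis
    by (intro specializesI[of _ q _ p])
       (auto simp: rpermute_Fract mpermute_eq_0_iff simp flip: mpermute_def)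
qed

section \<open>Variables, and univariate polynomials evaluated at them\<close>

lemma lookup_X: "Poly_Mapping.lookup (X i) m = (if m = Poly_Mapping.single i 1 then 1 else 0)"
  by (auto simp: X_def lookup_single when_def)

lemma X_eq_iff [simp]: "X i = X j \<longleftrightarrow> i = j"
proof
  assume "X i = X j"
  then have "Poly_Mapping.lookup (X i) (Poly_Mapping.single i 1) = Poly_Mapping.lookup (X j) (Poly_Mapping.single i 1)"
    by (rule arg_cong)
  then have "Poly_Mapping.single i (1::nat) = Poly_Mapping.single j 1"
    unfolding lookup_X by (metis one_neq_zero)
  then have "Poly_Mapping.lookup (Poly_Mapping.single i (1::nat)) i = Poly_Mapping.lookup (Poly_Mapping.single j 1) i"
    by (rule arg_cong)
  then show "i = j"
    unfolding lookup_single when_def by (metis one_neq_zero)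
qed (rule arg_cong)

lemma X_nonzero [simp]: "X i \<noteq> 0"
proof
  assume "X i = 0"
  then have "Poly_Mapping.lookup (X i) (Poly_Mapping.single i 1) = Poly_Mapping.lookup (0 :: mpol) (Poly_Mapping.single i 1)"
    by (rule arg_cong)
  then show False
    unfolding lookup_X lookup_zero by simp
qed

lemma to_fract_prod: "to_fract (prod g A) = (\<Prod>a\<in>A. to_fract (g a))"
  by (induction A rule: infinite_finite_induct) simp_all

lemma to_fract_power: "to_fract (p ^ k) = to_fract p ^ k"
  by (induction k) simp_all

lemma apply_at_0 [simp]: "apply_at 0 i = 0"
  by (simp add: apply_at_def)

lemma apply_at_1 [simp]: "apply_at 1 i = 1"
  by (simp add: apply_at_def flip: one_pCons)

lemma apply_at_pCons: "apply_at (pCons a p) i = mconst (to_fract [:a:]) + X i * apply_at p i"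
  by (simp add: apply_at_def map_poly_pCons)

lemma msubst_apply_at_X:
  assumes "s i = X j"
  shows "msubst s (apply_at p i) = apply_at p j"
  by (induction p) (simp_all add: apply_at_pCons msubst_add msubst_mult assms)

lemma msubst_apply_at_0:
  assumes "s i = 0" "poly p 0 = 0"
  shows "msubst s (apply_at p i) = 0"
  using assms by (cases p) (simp_all add: apply_at_pCons msubst_add msubst_mult)

section \<open>Divisibility by products of differences\<close>

text \<open>A factor theorem: by linearity it suffices to treat monomials, where x_a^k - x_b^k is
  divisible by x_a - x_b.\<close>

lemma X_diff_dvd_diff_msubst: "X a - X b dvd P - msubst (X(a := X b)) P"
proof -
  let ?s = "X(a := X b)"
  have mon: "X a - X b dvd msubst_mon X m - msubst_mon ?s m" for m
  proof (cases "a \<in> Poly_Mapping.keys m")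
    case True
    let ?k = "Poly_Mapping.lookup m a"
    let ?R = "\<Prod>i\<in>Poly_Mapping.keys m - {a}. X i ^ Poly_Mapping.lookup m i"
    have "msubst_mon X m = X a ^ ?k * ?R" "msubst_mon ?s m = X b ^ ?k * ?R"
      using True by (simp_all add: msubst_mon_def prod.remove[of _ a])
    then have "msubst_mon X m - msubst_mon ?s m = (X a ^ ?k - X b ^ ?k) * ?R"
      by (simp add: left_diff_distrib)
    then show ?thesis
      using power_diff_sumr2[of "X a" ?k "X b"] by simp
  next
    case False
    then have "msubst_mon ?s m = msubst_mon X m"
      by (auto simp: msubst_mon_def intro!: prod.cong)
    then show ?thesis by simp
  qed
  have "P - msubst ?s P = msubst X P - msubst ?s P"
    by simp
  also have "\<dots> = (\<Sum>m\<in>Poly_Mapping.keys P. mconst (Poly_Mapping.lookup P m) *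
      (msubst_mon X m - msubst_mon ?s m))"
    unfolding msubst_def msubst_mon_def[symmetric] right_diff_distrib by (rule sum_subtractf[symmetric])
  finally show ?thesis
    using mon by (auto intro!: dvd_sum dvd_mult)
qed

lemma msubst_diff: "msubst s (P - Q) = msubst s P - msubst s Q"
  using msubst_add[of s "P - Q" Q] by simp

text \<open>Factors are split off one at a time. Putting x_a = x_b kills \<open>N\<close> but none
  of the other factors, so in the integral domain it kills the cofactor, to which the factor theorem
  applies.\<close>

lemma prod_X_diff_dvd:
  assumes "finite A" "\<And>a b. (a, b) \<in> A \<Longrightarrow> a \<noteq> b \<and> (b, a) \<notin> A"
    and "\<And>a b. (a, b) \<in> A \<Longrightarrow> msubst (X(a := X b)) N = 0"
  shows "(\<Prod>(a, b)\<in>A. X a - X b) dvd N"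
  using assms
proof (induction A rule: finite_induct)
  case (insert p A)
  obtain a b where p: "p = (a, b)" by force
  let ?\<phi> = "msubst (X(a := X b))"
  have "(\<Prod>(a, b)\<in>A. X a - X b) dvd N"
    by (rule insert.IH) (use insert.prems in blast)+
  then obtain R where R: "N = (\<Prod>(a, b)\<in>A. X a - X b) * R"
    by (auto elim: dvdE)
  \<comment> \<open>Among pairs of distinct indices only (a, b) and (b, a) give a difference
    vanishing at x_a = x_b, and neither lies in \<open>A\<close>.\<close>
  have "?\<phi> (X c - X d) \<noteq> 0" if "(c, d) \<in> A" for c d
    using that insert.prems(1)[of c d] insert.prems(1)[of a b] insert.hyps p
    by (auto simp: msubst_diff)
  then have "?\<phi> (\<Prod>(a, b)\<in>A. X a - X b) \<noteq> 0"
    using insert.hyps by (auto simp: msubst_prod case_prod_beta)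
  moreover have "?\<phi> N = 0"
    by (rule insert.prems(2)) (simp add: p)
  ultimately have "?\<phi> R = 0"
    by (simp add: R msubst_mult)
  then have "X a - X b dvd R"
    using X_diff_dvd_diff_msubst[of a b R] by simp
  then show ?case
    using insert.hyps by (simp add: R p mult.commute mult_dvd_mono)
qed simp

section \<open>Hall-Littlewood type sums\<close>

definition hl_factor :: "nat \<Rightarrow> nat \<Rightarrow> ratfun" where
  "hl_factor i j = to_fract (X i - tvar * X j) / to_fract (X i - X j)"

definition pairs :: "nat \<Rightarrow> (nat \<times> nat) set" where
  "pairs n = {(i, j). 1 \<le> i \<and> i < j \<and> j \<le> n}"

text \<open>For a permutation \<open>w\<close> and g i = \<open>f (part lam i)\<close> this is the
  summand of \<open>w\<close> in \<open>Ftt\<close>. The polynomials are indexed by position, so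
  omitting position k turns them into \<open>g \<circ> skip k\<close>.\<close>

definition hl_term :: "(nat \<Rightarrow> complex poly) \<Rightarrow> nat \<Rightarrow> (nat \<Rightarrow> nat) \<Rightarrow> ratfun" where
  "hl_term g n w = to_fract (\<Prod>i\<in>{1..n}. apply_at (g i) (w i)) * (\<Prod>(i, j)\<in>pairs n. hl_factor (w i) (w j))"

definition hl_sum :: "(nat \<Rightarrow> complex poly) \<Rightarrow> nat \<Rightarrow> ratfun" where
  "hl_sum g n = (\<Sum>\<sigma> | \<sigma> permutes {1..n}. hl_term g n \<sigma>)"

lemma mem_pairs_iff: "(i, j) \<in> pairs n \<longleftrightarrow> 1 \<le> i \<and> i < j \<and> j \<le> n"
  by (simp add: pairs_def)

lemma finite_pairs [simp]: "finite (pairs n)"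
  by (rule finite_subset[of _ "{1..n} \<times> {1..n}"]) (auto simp: pairs_def)

lemma msubst_tvar [simp]: "msubst s tvar = tvar"
  by (simp add: tvar_def)

lemma specializes_hl_factor:
  assumes "s i = X i'" "s j = X j'" "i' \<noteq> j'"
  shows "specializes s (hl_factor i j) (hl_factor i' j')"
  using specializes_divide_to_fract[of s "X i - X j" "X i - tvar * X j"] assms
  by (simp add: hl_factor_def msubst_diff msubst_mult)

lemma specializes_hl_term:
  assumes "\<And>i. i \<in> {1..n} \<Longrightarrow> s (w i) = X (w' i)" "inj_on w' {1..n}"
  shows "specializes s (hl_term g n w) (hl_term g n w')"
proof -
  have "specializes s (hl_factor (w i) (w j)) (hl_factor (w' i) (w' j))" if "(i, j) \<in> pairs n" for i j
    using that assms by (intro specializes_hl_factor) (auto simp: pairs_def inj_on_eq_iff)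
  moreover have "msubst s (\<Prod>i\<in>{1..n}. apply_at (g i) (w i)) = (\<Prod>i\<in>{1..n}. apply_at (g i) (w' i))"
    using assms by (auto simp: msubst_prod intro!: prod.cong msubst_apply_at_X)
  ultimately show ?thesis
    unfolding hl_term_def
    by (metis (mono_tags, lifting) specializes_to_fract specializes_mult specializes_prod case_prod_conv surj_pair)
qed

text \<open>Both sides are specializations of the same function under the same substitution.\<close>

lemma rpermute_hl_term:
  assumes "\<sigma> permutes {1..n}"
  shows "rpermute \<sigma> (hl_term g n id) = hl_term g n \<sigma>"
proof (rule specializes_unique)
  show "specializes (\<lambda>i. X (\<sigma> i)) (hl_term g n id) (rpermute \<sigma> (hl_term g n id))"
    using assms by (intro specializes_rpermute permutes_bij)
  show "specializes (\<lambda>i. X (\<sigma> i)) (hl_term g n id) (hl_term g n \<sigma>)"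
    using permutes_inj_on[OF assms] by (intro specializes_hl_term) auto
qed

text \<open>\<open>d\<close> is the number n - l of zero parts, kept as a separate argument: passing
  from n to n + 1 raises both by one.\<close>

definition Ftt_coeff :: "nat \<Rightarrow> nat \<Rightarrow> ratfun" where
  "Ftt_coeff n d = (1 - to_fract tvar) ^ n / (\<Prod>i\<in>{1..d}. 1 - to_fract tvar ^ i)"

lemma Ftt_eq: "Ftt f lam n = Ftt_coeff n (n - length lam) * hl_sum (\<lambda>i. f (part lam i)) n"
proof -
  have "(\<Prod>i\<in>{1..n}. to_fract (apply_at (f (part lam i)) i)) *
      (\<Prod>(i, j)\<in>{(i, j). 1 \<le> i \<and> i < j \<and> j \<le> n}.
        (to_fract (X i) - to_fract tvar * to_fract (X j)) / (to_fract (X i) - to_fract (X j)))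
    = hl_term (\<lambda>i. f (part lam i)) n id"
    by (simp add: hl_term_def hl_factor_def pairs_def to_fract_prod)
  then show ?thesis
    unfolding Ftt_def Let_def Ftt_coeff_def hl_sum_def
    by (simp add: rpermute_hl_term)
qed

section \<open>Polynomiality and symmetry\<close>

definition vandermonde :: "nat \<Rightarrow> mpol" where
  "vandermonde n = (\<Prod>(i, j)\<in>pairs n. X i - X j)"

lemma vandermonde_nonzero: "vandermonde n \<noteq> 0"
  by (auto simp: vandermonde_def mem_pairs_iff)

lemma specializes_hl_sum_permute:
  assumes \<tau>: "\<tau> permutes {1..n}"
  shows "specializes (\<lambda>i. X (\<tau> i)) (hl_sum g n) (hl_sum g n)"
proof -
  have "hl_sum g n = (\<Sum>\<sigma> | \<sigma> permutes {1..n}. hl_term g n (\<tau> \<circ> \<sigma>))"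
    unfolding hl_sum_def
    by (rule sum.reindex_bij_witness[of _ "\<lambda>\<sigma>. \<tau> \<circ> \<sigma>" "\<lambda>\<sigma>. inv \<tau> \<circ> \<sigma>"])
       (use \<tau> in \<open>auto intro: permutes_compose permutes_inv simp: permutes_inv_o o_assoc\<close>)
  moreover have "specializes (\<lambda>i. X (\<tau> i)) (hl_term g n \<sigma>) (hl_term g n (\<tau> \<circ> \<sigma>))"
    if "\<sigma> permutes {1..n}" for \<sigma>
    using permutes_inj_on[OF permutes_compose[OF that \<tau>]] by (intro specializes_hl_term) auto
  ultimately show ?thesis
    unfolding hl_sum_def by (metis (mono_tags, lifting) mem_Collect_eq specializes_sum)
qed

text \<open>The denominators x_(\<sigma> i) - x_(\<sigma> j) run once through all unordered pairs of
  indices, so their product divides the Vandermonde product.\<close>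

lemma hl_term_vandermonde:
  assumes \<sigma>: "\<sigma> permutes {1..n}"
  shows "\<exists>N. hl_term g n \<sigma> * to_fract (vandermonde n) = to_fract N"
proof -
  let ?A = "map_prod \<sigma> \<sigma> ` pairs n"
  have inj: "inj \<sigma>"
    using \<sigma> by (rule permutes_inj)
  have "(\<Prod>(a, b)\<in>?A. X a - X b) dvd vandermonde n"
  proof (rule prod_X_diff_dvd)
    show "a \<noteq> b \<and> (b, a) \<notin> ?A" if "(a, b) \<in> ?A" for a b
      using that inj by (auto simp: mem_pairs_iff inj_eq)
    show "msubst (X(a := X b)) (vandermonde n) = 0" if ab: "(a, b) \<in> ?A" for a b
    proof -
      obtain i j where ij: "a = \<sigma> i" "b = \<sigma> j" "(i, j) \<in> pairs n"
        using ab by auto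
      then have "a \<in> {1..n}" "b \<in> {1..n}" "a \<noteq> b"
        using permutes_in_image[OF \<sigma>] inj by (auto simp: mem_pairs_iff inj_eq)
      \<comment> \<open>\<open>\<sigma>\<close> may reverse the order of a pair; in either
        orientation the matching factor vanishes at x_a = x_b.\<close>
      then have "(a, b) \<in> pairs n \<or> (b, a) \<in> pairs n"
        by (auto simp: mem_pairs_iff)
      then have "\<exists>p\<in>pairs n. msubst (X(a := X b)) (case p of (i, j) \<Rightarrow> X i - X j) = 0"
        by (elim disjE) (force simp: msubst_diff)+
      then show ?thesis
        unfolding vandermonde_def msubst_prod by (intro prod_zero) auto
    qed
  qed simp
  also have "(\<Prod>(a, b)\<in>?A. X a - X b) = (\<Prod>(i, j)\<in>pairs n. X (\<sigma> i) - X (\<sigma> j))"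
    by (subst prod.reindex) (auto intro: inj_on_subset[OF prod.inj_map[OF inj inj]] simp: case_prod_beta)
  finally obtain K where K: "vandermonde n = (\<Prod>(i, j)\<in>pairs n. X (\<sigma> i) - X (\<sigma> j)) * K"
    by (auto elim: dvdE)
  have nz: "(\<Prod>(i, j)\<in>pairs n. to_fract (X (\<sigma> i) - X (\<sigma> j))) \<noteq> 0"
    using inj by (auto simp: inj_eq mem_pairs_iff)
  have "hl_term g n \<sigma> * to_fract (vandermonde n) =
    to_fract ((\<Prod>i\<in>{1..n}. apply_at (g i) (\<sigma> i)) * (\<Prod>(i, j)\<in>pairs n. X (\<sigma> i) - tvar * X (\<sigma> j)) * K)"
    using nz unfolding K hl_term_def hl_factor_def
    by (simp add: to_fract_prod prod_dividef case_prod_beta del: to_fract_diff)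
  then show ?thesis ..
qed

lemma mconst_eq_iff [simp]: "mconst a = mconst b \<longleftrightarrow> a = b"
  by (metis mconst_def lookup_single_eq)

text \<open>Characteristic 0, inherited from the complex numbers: 2 = 0 would descend through
  \<open>mconst\<close> and \<open>to_fract\<close> to complex polynomials.\<close>

lemma mpol_eq_uminus_self: "P = 0" if "P = - P" for P :: mpol
proof -
  have "2 * P = 0"
    using that by (metis add.right_inverse mult_2)
  moreover have "(2 :: mpol) \<noteq> 0"
  proof
    assume "(2 :: mpol) = 0"
    then have "mconst (to_fract (1 + 1)) = mconst 0"
      unfolding to_fract_add to_fract_1 mconst_add mconst_1 mconst_0 by simp
    then have "to_fract (1 + 1) = (to_fract 0 :: ct)"
      by (simp only: mconst_eq_iff to_fract_0)
    then show False
      by (simp only: to_fract_eq_iff one_add_one) simp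
  qed
  ultimately show ?thesis
    by simp
qed

text \<open>
  Applying the transposition (a b) to both sides of \<open>N = S \<Delta>\<close> and cancelling shows that
  \<open>N\<close> changes sign after putting x_a = x_b; no sign of a permutation is needed.
\<close>

lemma hl_sum_vandermonde_vanishes:
  assumes N: "hl_sum g n * to_fract (vandermonde n) = to_fract N" and ab: "(a, b) \<in> pairs n"
  shows "msubst (X(a := X b)) N = 0"
proof -
  let ?\<tau> = "transpose a b" and ?\<phi> = "msubst (X(a := X b))"
  let ?t = "msubst (\<lambda>i. X (?\<tau> i))"
  define E where "E = (\<Prod>(i, j)\<in>pairs n - {(a, b)}. X i - X j)"
  have vdm: "vandermonde n = (X a - X b) * E"
    unfolding vandermonde_def E_def using ab by (subst prod.remove[of _ "(a, b)"]) auto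
  have \<phi>E: "?\<phi> E \<noteq> 0"
    using ab by (auto simp: E_def msubst_prod case_prod_beta msubst_diff mem_pairs_iff)
  have neq: "a \<noteq> b"
    using ab by (auto simp: mem_pairs_iff)
  \<comment> \<open>Once x_a and x_b are identified, swapping them has no effect; so under
    \<open>?\<phi>\<close> the swapped \<open>N\<close> and \<open>E\<close> may be replaced by
    \<open>N\<close> and \<open>E\<close>.\<close>
  have \<phi>t: "?\<phi> (?t P) = ?\<phi> P" for P
    unfolding msubst_msubst
    by (rule arg_cong[where f = "\<lambda>s. msubst s P"]) (auto simp: fun_eq_iff transpose_def)
  have "?\<tau> permutes {1..n}"
    using ab by (intro permutes_swap_id) (auto simp: mem_pairs_iff)
  then have "specializes (\<lambda>i. X (?\<tau> i)) (to_fract N) (hl_sum g n * to_fract (?t (vandermonde n)))"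
    unfolding N[symmetric] by (intro specializes_mult specializes_hl_sum_permute specializes_to_fract)
  then have "to_fract (?t N) = hl_sum g n * to_fract (?t (vandermonde n))"
    using specializes_unique specializes_to_fract by blast
  then have "to_fract (?t N * vandermonde n) = to_fract (N * ?t (vandermonde n))"
    by (simp add: N[symmetric])
  then have "?t N * vandermonde n = N * ?t (vandermonde n)"
    by (simp only: to_fract_eq_iff)
  also have "?t (vandermonde n) = - ((X a - X b) * ?t E)"
    by (simp add: vdm msubst_mult msubst_diff algebra_simps)
  finally have "(X a - X b) * (?t N * E) = (X a - X b) * - (N * ?t E)"
    by (simp add: vdm algebra_simps)
  then have "?t N * E = - (N * ?t E)"
    using neq by (simp only: mult_cancel_left right_minus_eq X_eq_iff simp_thms)
  then have "?\<phi> (?t N * E + N * ?t E) = 0"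
    by simp
  then have "?\<phi> N * ?\<phi> E = - (?\<phi> N * ?\<phi> E)"
    unfolding msubst_add msubst_mult \<phi>t by (simp only: eq_neg_iff_add_eq_0)
  then have "?\<phi> N * ?\<phi> E = 0"
    by (rule mpol_eq_uminus_self)
  with \<phi>E show ?thesis
    by simp
qed

lemma hl_sum_polynomial: "\<exists>P. hl_sum g n = to_fract P"
proof -
  have "\<forall>\<sigma>\<in>{\<sigma>. \<sigma> permutes {1..n}}. \<exists>N. hl_term g n \<sigma> * to_fract (vandermonde n) = to_fract N"
    using hl_term_vandermonde by blast
  then obtain N where "\<And>\<sigma>. \<sigma> permutes {1..n} \<Longrightarrow> hl_term g n \<sigma> * to_fract (vandermonde n) = to_fract (N \<sigma>)"
    by (metis mem_Collect_eq)
  then have N: "hl_sum g n * to_fract (vandermonde n) = to_fract (\<Sum>\<sigma> | \<sigma> permutes {1..n}. N \<sigma>)"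
    by (simp add: hl_sum_def sum_distrib_right)
  have "vandermonde n dvd (\<Sum>\<sigma> | \<sigma> permutes {1..n}. N \<sigma>)"
    unfolding vandermonde_def
  proof (rule prod_X_diff_dvd)
    show "msubst (X(a := X b)) (\<Sum>\<sigma> | \<sigma> permutes {1..n}. N \<sigma>) = 0" if "(a, b) \<in> pairs n" for a b
      using N that by (rule hl_sum_vandermonde_vanishes)
  qed (auto simp: mem_pairs_iff)
  then obtain P where "(\<Sum>\<sigma> | \<sigma> permutes {1..n}. N \<sigma>) = vandermonde n * P"
    by (auto elim: dvdE)
  with N have "hl_sum g n * to_fract (vandermonde n) = to_fract P * to_fract (vandermonde n)"
    by (simp only: to_fract_mult mult.commute)
  then show ?thesis
    using vandermonde_nonzero by auto
qed

text \<open>Zeroing the variables outside \<open>V\<close> removes every monomial containing one of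
  them and keeps all others. In this form the condition can be transported along
  \<open>specializes\<close>.\<close>

lemma mvars_subsetI:
  assumes "msubst (\<lambda>i. if i \<in> V then X i else 0) P = P"
  shows "mvars P \<subseteq> V"
proof (rule subsetI, rule ccontr)
  let ?s = "\<lambda>i. if i \<in> V then X i else 0"
  fix i assume "i \<in> mvars P" "i \<notin> V"
  then obtain m where m: "m \<in> Poly_Mapping.keys P" "i \<in> Poly_Mapping.keys m"
    by (auto simp: mvars_def)
  have "Poly_Mapping.lookup (mconst c * msubst_mon ?s m') m = 0" for c m'
  proof (cases "Poly_Mapping.keys m' \<subseteq> V")
    case True
    then have "msubst_mon ?s m' = msubst_mon X m'"
      unfolding msubst_mon_def by (intro prod.cong) auto
    moreover have "m' \<noteq> m"
      using True m \<open>i \<notin> V\<close> by auto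
    ultimately show ?thesis
      by (simp add: msubst_mon_X mconst_def mult_single lookup_single)
  next
    case False
    then obtain j where "j \<in> Poly_Mapping.keys m'" "j \<notin> V"
      by auto
    then have "msubst_mon ?s m' = 0"
      unfolding msubst_mon_def by (intro prod_zero) (auto simp: in_keys_iff intro!: bexI[of _ j])
    then show ?thesis by simp
  qed
  then have "Poly_Mapping.lookup (msubst ?s P) m = 0"
    unfolding msubst_def msubst_mon_def[symmetric] lookup_sum by simp
  with assms m show False
    by (simp add: in_keys_iff)
qed

section \<open>The normalizing factor as an element of C(t)\<close>

lemma mconst_diff: "mconst (a - b) = mconst a - mconst b"
  using mconst_add[of "a - b" b] by simp

lemma mconst_power: "mconst (a ^ k) = mconst a ^ k"
  by (induction k) (simp_all add: mconst_mult)

lemma mconst_prod: "mconst (prod g A) = (\<Prod>a\<in>A. mconst (g a))"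
  by (induction A rule: infinite_finite_induct) (simp_all add: mconst_mult)

lemma to_fract_mconst_divide:
  "to_fract (mconst (a / b)) = to_fract (mconst a) / to_fract (mconst b)"
proof (cases "b = 0")
  case False
  then have "to_fract (mconst b) \<noteq> 0"
    by (metis mconst_0 mconst_eq_iff to_fract_eq_0_iff)
  moreover have "to_fract (mconst (a / b)) * to_fract (mconst b) = to_fract (mconst a)"
    using False by (simp flip: to_fract_mult mconst_mult)
  ultimately show ?thesis
    by (simp add: field_simps)
qed simp

text \<open>Only t occurs, so the factor lies in the coefficient field C(t); it preserves
  polynomiality and is fixed by every substitution.\<close>

lemma Ftt_coeff_mconst: "\<exists>c. Ftt_coeff n d = to_fract (mconst c)"
proof
  let ?T = "to_fract [:0, 1:] :: ct"
  show "Ftt_coeff n d = to_fract (mconst ((1 - ?T) ^ n / (\<Prod>i\<in>{1..d}. 1 - ?T ^ i)))"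
    by (simp add: Ftt_coeff_def tvar_def to_fract_mconst_divide mconst_power mconst_diff mconst_prod
        to_fract_power to_fract_prod)
qed

text \<open>An identity t^k = 1 would hold already among complex polynomials in t, where t = 0 gives
  0 = 1. Hence the denominator factors 1 - t^k do not vanish.\<close>

lemma tvar_power_neq_1: "k > 0 \<Longrightarrow> to_fract tvar ^ k \<noteq> 1"
proof
  assume k: "k > 0" and "to_fract tvar ^ k = 1"
  then have "to_fract (tvar ^ k) = to_fract 1"
    by (simp only: to_fract_power to_fract_1)
  then have "tvar ^ k = 1"
    by (simp only: to_fract_eq_iff)
  then have "to_fract ([:0, 1:] ^ k) = (to_fract 1 :: ct)"
    unfolding tvar_def mconst_power[symmetric] to_fract_power[symmetric] to_fract_1
    by (metis mconst_1 mconst_eq_iff)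
  then have "[:0, 1:] ^ k = (1 :: complex poly)"
    by (simp only: to_fract_eq_iff)
  then have "poly ([:0, 1:] ^ k) 0 = (1 :: complex)"
    by simp
  with k show False
    by (simp add: zero_power)
qed

lemma Ftt_polynomial: "\<exists>P. Ftt f lam n = to_fract P"
  using Ftt_coeff_mconst hl_sum_polynomial by (metis Ftt_eq to_fract_mult)

lemma specializes_Ftt:
  assumes "specializes s (hl_sum (\<lambda>i. f (part lam i)) n) r"
  shows "specializes s (Ftt f lam n) (Ftt_coeff n (n - length lam) * r)"
proof -
  obtain c where c: "Ftt_coeff n (n - length lam) = to_fract (mconst c)"
    using Ftt_coeff_mconst by blast
  show ?thesis
    unfolding Ftt_eq c using assms specializes_to_fract[of s "mconst c"]
    by (auto intro: specializes_mult)
qed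

text \<open>Each substitution in question specializes \<open>Ftt f lam n\<close> to itself, and by
  uniqueness it then fixes \<open>P\<close>.\<close>

lemma symmetric_mpol_Ftt:
  assumes P: "Ftt f lam n = to_fract P"
  shows "symmetric_mpol n P"
  unfolding symmetric_mpol_def
proof safe
  fix \<tau> assume "\<tau> permutes {1..n}"
  then have "specializes (\<lambda>i. X (\<tau> i)) (Ftt f lam n) (Ftt f lam n)"
    by (subst (2) Ftt_eq) (intro specializes_Ftt specializes_hl_sum_permute)
  then have "to_fract (mpermute \<tau> P) = to_fract P"
    unfolding P mpermute_def by (intro specializes_unique[OF specializes_to_fract])
  then show "mpermute \<tau> P = P"
    by (simp only: to_fract_eq_iff)
next
  \<comment> \<open>Zeroing the variables outside {1..n} fixes every summand, since
    \<open>\<sigma>\<close> keeps these indices among themselves.\<close>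
  let ?s = "\<lambda>i. if i \<in> {1..n} then X i else 0"
  have "specializes ?s (hl_sum g n) (hl_sum g n)" for g
    unfolding hl_sum_def
  proof (rule specializes_sum)
    show "specializes ?s (hl_term g n \<sigma>) (hl_term g n \<sigma>)" if "\<sigma> \<in> {\<sigma>. \<sigma> permutes {1..n}}" for \<sigma>
      using that permutes_in_image[of \<sigma> "{1..n}"] by (intro specializes_hl_term) (auto intro: permutes_inj_on)
  qed
  then have "specializes ?s (Ftt f lam n) (Ftt f lam n)"
    by (subst (2) Ftt_eq) (intro specializes_Ftt)
  then have "to_fract (msubst ?s P) = to_fract P"
    unfolding P by (intro specializes_unique[OF specializes_to_fract])
  then have "mvars P \<subseteq> {1..n}"
    by (intro mvars_subsetI) (simp only: to_fract_eq_iff)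
  then show "i \<in> {1..n}" if "i \<in> mvars P" for i
    using that by blast
qed

section \<open>Stability\<close>

text \<open>The increasing enumeration of the natural numbers other than k. It matches the positions
  of a word with those of the word lengthened by a letter at position k.\<close>

definition skip :: "nat \<Rightarrow> nat \<Rightarrow> nat" where
  "skip k i = (if i < k then i else Suc i)"

text \<open>
  Read as a word, the result is \<open>\<tau>\<close>(1) ... \<open>\<tau>\<close>(n) with the letter n + 1 inserted at
  position k.
\<close>

definition insert_value :: "nat \<Rightarrow> nat \<Rightarrow> (nat \<Rightarrow> nat) \<Rightarrow> nat \<Rightarrow> nat" where
  "insert_value n k \<tau> i =
     (if i = k then Suc n else if k < i \<and> i \<le> Suc n then \<tau> (i - 1) else \<tau> i)"

lemma inj_skip: "inj (skip k)"
  by (auto simp: inj_def skip_def split: if_splits)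

lemma skip_image:
  assumes "k \<in> {1..Suc n}"
  shows "{1..Suc n} = insert k (skip k ` {1..n})"
proof -
  have "i \<in> skip k ` {1..n}" if "i \<in> {1..Suc n}" "i \<noteq> k" for i
    using that assms
    by (intro image_eqI[of _ _ "if i < k then i else i - 1"]) (auto simp: skip_def)
  moreover have "skip k ` {1..n} \<subseteq> {1..Suc n}"
    by (auto simp: skip_def)
  ultimately show ?thesis
    using assms by blast
qed

lemma prod_atLeastAtMost_Suc_skip:
  assumes "k \<in> {1..Suc n}"
  shows "(\<Prod>i\<in>{1..Suc n}. h i) = h k * (\<Prod>i\<in>{1..n}. h (skip k i))"
proof -
  have "k \<notin> skip k ` {1..n}"
    by (auto simp: skip_def)
  then show ?thesis
    unfolding skip_image[OF assms] using inj_skip[of k]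
    by (simp add: prod.reindex inj_on_def inj_def)
qed

text \<open>A pair either avoids k, and then comes from a pair in {1..n} because
  \<open>skip k\<close> is increasing, or has k as its second or first entry.\<close>

lemma prod_pairs_Suc_skip:
  assumes k: "k \<in> {1..Suc n}"
  shows "(\<Prod>(i, j)\<in>pairs (Suc n). h i j) =
    (\<Prod>(i, j)\<in>pairs n. h (skip k i) (skip k j)) * ((\<Prod>i\<in>{1..<k}. h i k) * (\<Prod>j\<in>{k<..Suc n}. h k j))"
proof -
  let ?A = "map_prod (skip k) (skip k) ` pairs n"
  let ?B = "(\<lambda>i. (i, k)) ` {1..<k}" and ?C = "(\<lambda>j. (k, j)) ` {k<..Suc n}"
  have "pairs (Suc n) = ?A \<union> (?B \<union> ?C)"
  proof (intro subset_antisym subrelI)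
    fix i j assume ij: "(i, j) \<in> pairs (Suc n)"
    show "(i, j) \<in> ?A \<union> (?B \<union> ?C)"
    proof (cases "i = k \<or> j = k")
      case True
      then show ?thesis
        using ij by (auto simp: mem_pairs_iff)
    next
      case False
      then have "i \<in> skip k ` {1..n}" "j \<in> skip k ` {1..n}"
        using ij k skip_image[OF k] by (auto simp: mem_pairs_iff)
      then obtain i' j' where "i = skip k i'" "j = skip k j'" "i' \<in> {1..n}" "j' \<in> {1..n}"
        by auto
      with ij have "(i, j) \<in> ?A"
        by (intro image_eqI[of _ _ "(i', j')"]) (auto simp: mem_pairs_iff skip_def split: if_splits)
      then show ?thesis ..
    qed
  qed (use k in \<open>auto simp: mem_pairs_iff skip_def\<close>)
  moreover have "?A \<inter> (?B \<union> ?C) = {}" "?B \<inter> ?C = {}"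
    by (auto simp: skip_def split: if_splits)
  moreover have "inj_on (map_prod (skip k) (skip k)) (pairs n)"
    by (intro inj_on_subset[OF prod.inj_map[OF inj_skip inj_skip]]) simp
  ultimately show ?thesis
    by (simp add: prod.union_disjoint prod.reindex inj_on_def case_prod_beta)
qed

lemma insert_value_permutes:
  assumes k: "k \<in> {1..Suc n}" and \<tau>: "\<tau> permutes {1..n}"
  shows "insert_value n k \<tau> permutes {1..Suc n}"
proof (rule inj_imp_permutes)
  have le: "\<tau> i \<in> {1..n}" if "i \<in> {1..n}" for i
    using permutes_in_image[OF \<tau>] that by blast
  have val: "insert_value n k \<tau> (skip k i) = \<tau> i" if "i \<in> {1..n}" for i
    using that by (auto simp: insert_value_def skip_def)
  have "inj_on (insert_value n k \<tau>) (skip k ` {1..n})"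
    by (auto intro!: inj_onI simp: val inj_eq[OF permutes_inj[OF \<tau>]])
  moreover have "insert_value n k \<tau> ` (skip k ` {1..n}) \<subseteq> {1..n}"
    using le by (simp add: image_subset_iff val del: atLeastAtMost_iff)
  moreover have "insert_value n k \<tau> k \<notin> {1..n}"
    by (simp add: insert_value_def)
  ultimately show "inj_on (insert_value n k \<tau>) {1..Suc n}"
    unfolding skip_image[OF k] by (simp only: inj_on_insert) blast
  show "insert_value n k \<tau> i \<in> {1..Suc n}" if i: "i \<in> {1..Suc n}" for i
  proof -
    consider "i = k" | i' where "i = skip k i'" "i' \<in> {1..n}"
      using i unfolding skip_image[OF k] by blast
    then show ?thesis
    proof cases
      case 1
      then show ?thesis by (simp add: insert_value_def)
    next
      case 2
      then show ?thesis using val le[of i'] by auto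
    qed
  qed
  show "insert_value n k \<tau> i = i" if "i \<notin> {1..Suc n}" for i
    using that k permutes_not_in[OF \<tau>, of i] by (auto simp: insert_value_def)
qed simp

text \<open>Each permutation of n + 1 letters arises from exactly one pair: k is the position of the
  letter n + 1, and deleting this letter gives \<open>\<tau>\<close>.\<close>

lemma sum_permutes_Suc:
  "(\<Sum>\<sigma> | \<sigma> permutes {1..Suc n}. h \<sigma>) =
     (\<Sum>k\<in>{1..Suc n}. \<Sum>\<tau> | \<tau> permutes {1..n}. h (insert_value n k \<tau>))"
proof -
  \<comment> \<open>Deletes the letter n + 1 from the word of \<open>\<sigma>\<close>. Indices above
    n are fixed by definition; 0 is fixed because the deleted position is at least 1.\<close>
  define rem where "rem \<sigma> i = (if i \<le> n then \<sigma> (skip (inv \<sigma> (Suc n)) i) else i)" for \<sigma> i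
  have rem_permutes: "rem \<sigma> permutes {1..n}" if \<sigma>: "\<sigma> permutes {1..Suc n}" for \<sigma>
  proof (rule inj_imp_permutes)
    have inj: "inj \<sigma>"
      using \<sigma> by (rule permutes_inj)
    have neq: "\<sigma> (skip (inv \<sigma> (Suc n)) i) \<noteq> Suc n" for i
    proof
      assume "\<sigma> (skip (inv \<sigma> (Suc n)) i) = Suc n"
      then have "inv \<sigma> (Suc n) = skip (inv \<sigma> (Suc n)) i"
        by (metis permutes_inverses(2)[OF \<sigma>])
      then show False
        by (auto simp: skip_def split: if_splits)
    qed
    show "rem \<sigma> i \<in> {1..n}" if "i \<in> {1..n}" for i
    proof -
      have "skip (inv \<sigma> (Suc n)) i \<in> {1..Suc n}"
        using that by (auto simp: skip_def)
      then have "\<sigma> (skip (inv \<sigma> (Suc n)) i) \<in> {1..Suc n}"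
        by (simp only: permutes_in_image[OF \<sigma>])
      with neq[of i] that show ?thesis
        by (simp add: rem_def)
    qed
    show "inj_on (rem \<sigma>) {1..n}"
      by (auto intro!: inj_onI simp: rem_def inj_eq[OF inj] inj_eq[OF inj_skip])
    have "skip (inv \<sigma> (Suc n)) 0 = 0"
      using permutes_in_image[OF permutes_inv[OF \<sigma>], of "Suc n"] by (auto simp: skip_def)
    then show "rem \<sigma> i = i" if "i \<notin> {1..n}" for i
      using that permutes_not_in[OF \<sigma>, of 0] by (cases "i = 0") (auto simp: rem_def)
  qed simp
  have inv_in: "inv \<sigma> (Suc n) \<in> {1..Suc n}" if "\<sigma> permutes {1..Suc n}" for \<sigma>
    using permutes_in_image[OF permutes_inv[OF that], of "Suc n"] by auto
  have ins_rem: "insert_value n (inv \<sigma> (Suc n)) (rem \<sigma>) = \<sigma>" if \<sigma>: "\<sigma> permutes {1..Suc n}" for \<sigma>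
  proof
    fix i
    show "insert_value n (inv \<sigma> (Suc n)) (rem \<sigma>) i = \<sigma> i"
      using inv_in[OF \<sigma>] permutes_not_in[OF \<sigma>, of i] permutes_inverses(1)[OF \<sigma>, of "Suc n"]
      by (auto simp: insert_value_def rem_def skip_def)
  qed
  have inv_ins: "inv (insert_value n k \<tau>) (Suc n) = k" if "k \<in> {1..Suc n}" "\<tau> permutes {1..n}" for k \<tau>
    using permutes_inverses(2)[OF insert_value_permutes[OF that], of k] by (simp add: insert_value_def)
  have rem_ins: "rem (insert_value n k \<tau>) = \<tau>" if "k \<in> {1..Suc n}" "\<tau> permutes {1..n}" for k \<tau>
  proof
    fix i
    show "rem (insert_value n k \<tau>) i = \<tau> i"
      using that permutes_not_in[OF that(2), of i]
      by (auto simp: rem_def inv_ins insert_value_def skip_def)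
  qed
  have "(\<Sum>\<sigma> | \<sigma> permutes {1..Suc n}. h \<sigma>) =
    (\<Sum>(k, \<tau>)\<in>{1..Suc n} \<times> {\<tau>. \<tau> permutes {1..n}}. h (insert_value n k \<tau>))"
    by (rule sum.reindex_bij_witness[of _ "\<lambda>(k, \<tau>). insert_value n k \<tau>" "\<lambda>\<sigma>. (inv \<sigma> (Suc n), rem \<sigma>)"])
       (use inv_in in \<open>auto simp: rem_permutes ins_rem inv_ins rem_ins insert_value_permutes simp del: atLeastAtMost_iff One_nat_def\<close>)
  then show ?thesis
    by (simp only: sum.cartesian_product)
qed

text \<open>Separates the factors that involve position k, the place of x_(n+1): its polynomial, the
  pairs ending in k and the pairs starting with k.\<close>

lemma hl_term_insert_value:
  assumes k: "k \<in> {1..Suc n}"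
  shows "hl_term g (Suc n) (insert_value n k \<tau>) =
    to_fract (apply_at (g k) (Suc n)) * hl_term (g \<circ> skip k) n \<tau> *
      ((\<Prod>i\<in>{1..<k}. hl_factor (\<tau> i) (Suc n)) * (\<Prod>j\<in>{k<..Suc n}. hl_factor (Suc n) (\<tau> (j - 1))))"
proof -
  let ?w = "insert_value n k \<tau>"
  have val: "?w (skip k i) = \<tau> i" if "i \<le> n" for i
    using that by (auto simp: insert_value_def skip_def)
  have "(\<Prod>i\<in>{1..Suc n}. apply_at (g i) (?w i)) =
      apply_at (g k) (Suc n) * (\<Prod>i\<in>{1..n}. apply_at ((g \<circ> skip k) i) (\<tau> i))"
    unfolding prod_atLeastAtMost_Suc_skip[OF k] using val
    by (auto simp: insert_value_def[of n k \<tau> k] intro!: prod.cong)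
  moreover have "(\<Prod>(i, j)\<in>pairs n. hl_factor (?w (skip k i)) (?w (skip k j))) =
      (\<Prod>(i, j)\<in>pairs n. hl_factor (\<tau> i) (\<tau> j))"
    by (intro prod.cong) (auto simp: val mem_pairs_iff)
  moreover have "(\<Prod>i\<in>{1..<k}. hl_factor (?w i) (?w k)) = (\<Prod>i\<in>{1..<k}. hl_factor (\<tau> i) (Suc n))"
    by (intro prod.cong) (auto simp: insert_value_def)
  \<comment> \<open>Positions after k hold the letters of \<open>\<tau>\<close> moved up by one,
    hence j - 1.\<close>
  moreover have "(\<Prod>j\<in>{k<..Suc n}. hl_factor (?w k) (?w j)) =
      (\<Prod>j\<in>{k<..Suc n}. hl_factor (Suc n) (\<tau> (j - 1)))"
    by (intro prod.cong) (auto simp: insert_value_def)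
  ultimately show ?thesis
    unfolding hl_term_def prod_pairs_Suc_skip[OF k] by (simp add: mult_ac)
qed

lemma specializes_hl_term_insert_value:
  assumes k: "k \<in> {1..Suc n}" and \<tau>: "\<tau> permutes {1..n}"
  shows "specializes (X(Suc n := 0)) (hl_term g (Suc n) (insert_value n k \<tau>))
    (to_fract (msubst (X(Suc n := 0)) (apply_at (g k) (Suc n))) * hl_term (g \<circ> skip k) n \<tau> *
      to_fract tvar ^ (Suc n - k))"
proof -
  let ?s = "X(Suc n := 0)"
  have le: "\<tau> i \<noteq> Suc n" if "i \<in> {1..n}" for i
    using permutes_in_image[OF \<tau>, of i] that by auto
  \<comment> \<open>At x_(n+1) = 0 the factor becomes x_i / x_i here and (-t x_j) / (-x_j) in the
    next step; for i and j other than n + 1 these denominators are nonzero.\<close>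
  have left: "specializes ?s (hl_factor i (Suc n)) 1" if "i \<noteq> Suc n" for i
    using specializes_divide_to_fract[of ?s "X i - X (Suc n)" "X i - tvar * X (Suc n)"] that
    by (simp add: hl_factor_def msubst_diff msubst_mult)
  have right: "specializes ?s (hl_factor (Suc n) j) (to_fract tvar)" if "j \<noteq> Suc n" for j
    using specializes_divide_to_fract[of ?s "X (Suc n) - X j" "X (Suc n) - tvar * X j"] that
    by (simp add: hl_factor_def msubst_diff msubst_mult)
  have "specializes ?s (\<Prod>i\<in>{1..<k}. hl_factor (\<tau> i) (Suc n)) (\<Prod>i\<in>{1..<k}. 1)"
    using k by (intro specializes_prod left le) auto
  moreover have "specializes ?s (\<Prod>j\<in>{k<..Suc n}. hl_factor (Suc n) (\<tau> (j - 1))) (\<Prod>j\<in>{k<..Suc n}. to_fract tvar)"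
    using k by (intro specializes_prod right le) auto
  ultimately have "specializes ?s
      ((\<Prod>i\<in>{1..<k}. hl_factor (\<tau> i) (Suc n)) * (\<Prod>j\<in>{k<..Suc n}. hl_factor (Suc n) (\<tau> (j - 1))))
      ((\<Prod>i\<in>{1..<k}. 1) * (\<Prod>j\<in>{k<..Suc n}. to_fract tvar))"
    by (rule specializes_mult)
  moreover have "specializes ?s (hl_term (g \<circ> skip k) n \<tau>) (hl_term (g \<circ> skip k) n \<tau>)"
    using le permutes_inj_on[OF \<tau>] by (intro specializes_hl_term) auto
  ultimately show ?thesis
    unfolding hl_term_insert_value[OF k]
    by (intro specializes_mult specializes_to_fract) simp_all
qed

section \<open>Summation over the position of n + 1\<close>

lemma hl_term_cong: "(\<And>i. i \<in> {1..n} \<Longrightarrow> g i = g' i) \<Longrightarrow> hl_term g n w = hl_term g' n w"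
  by (simp add: hl_term_def)

lemma specializes_hl_sum_zero:
  assumes "l \<le> n" "\<And>k. 1 \<le> k \<Longrightarrow> k \<le> l \<Longrightarrow> poly (g k) 0 = 0" "\<And>k. l < k \<Longrightarrow> g k = 1"
  shows "specializes (X(Suc n := 0)) (hl_sum g (Suc n)) ((\<Sum>i<Suc n - l. to_fract tvar ^ i) * hl_sum g n)"
proof -
  let ?s = "X(Suc n := 0)" and ?t = "to_fract tvar"
  let ?c = "\<lambda>k. if k \<le> l then 0 else ?t ^ (Suc n - k)"
  have "specializes ?s (hl_term g (Suc n) (insert_value n k \<tau>)) (?c k * hl_term g n \<tau>)"
    if k: "k \<in> {1..Suc n}" and \<tau>: "\<tau> permutes {1..n}" for k \<tau>
  proof (cases "k \<le> l")
    case True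
    then have "msubst ?s (apply_at (g k) (Suc n)) = 0"
      using k assms(2) by (intro msubst_apply_at_0) auto
    with specializes_hl_term_insert_value[OF k \<tau>, of g] True show ?thesis
      by simp
  next
    case False
    \<comment> \<open>For k > l every polynomial from position k on is 1, so omitting position k
      does not change the sequence.\<close>
    then have "hl_term (g \<circ> skip k) n \<tau> = hl_term g n \<tau>"
      using assms(3) by (intro hl_term_cong) (auto simp: skip_def)
    with specializes_hl_term_insert_value[OF k \<tau>, of g] False assms(3) show ?thesis
      by (simp add: mult.commute)
  qed
  then have "specializes ?s (hl_sum g (Suc n))
      (\<Sum>k\<in>{1..Suc n}. \<Sum>\<tau> | \<tau> permutes {1..n}. ?c k * hl_term g n \<tau>)"
    unfolding hl_sum_def sum_permutes_Suc by (intro specializes_sum) auto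
  also have "(\<Sum>k\<in>{1..Suc n}. \<Sum>\<tau> | \<tau> permutes {1..n}. ?c k * hl_term g n \<tau>) =
      (\<Sum>k\<in>{1..Suc n}. ?c k) * hl_sum g n"
    by (simp only: hl_sum_def sum_distrib_left[symmetric] sum_distrib_right[symmetric])
  also have "(\<Sum>k\<in>{1..Suc n}. ?c k) = (\<Sum>k\<in>{l<..Suc n}. ?t ^ (Suc n - k))"
    by (rule sum.mono_neutral_cong_right) auto
  also have "\<dots> = (\<Sum>i<Suc n - l. ?t ^ i)"
    by (rule sum.reindex_bij_witness[of _ "\<lambda>i. Suc n - i" "\<lambda>k. Suc n - k"]) (use assms(1) in auto)
  finally show ?thesis .
qed

text \<open>Raising n multiplies by 1 - t and raising d divides by 1 - t^(d+1); the geometric sum (1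
  - t^(d+1)) / (1 - t) cancels both.\<close>

lemma Ftt_coeff_Suc: "Ftt_coeff (Suc n) (Suc d) * (\<Sum>i<Suc d. to_fract tvar ^ i) = Ftt_coeff n d"
proof -
  let ?t = "to_fract tvar"
  have nz: "1 - ?t ^ i \<noteq> 0" if "i > 0" for i
    using tvar_power_neq_1[OF that] by auto
  have "(1 - ?t) * (\<Sum>i<Suc d. ?t ^ i) = 1 - ?t ^ Suc d"
    by (rule sum_gp_basic[of ?t d, folded lessThan_Suc_atMost])
  moreover have prods: "(\<Prod>i\<in>{1..Suc d}. 1 - ?t ^ i) = (\<Prod>i\<in>{1..d}. 1 - ?t ^ i) * (1 - ?t ^ Suc d)"
    by (simp del: power_Suc)
  moreover have "Ftt_coeff (Suc n) (Suc d) * (\<Sum>i<Suc d. ?t ^ i) =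
      Ftt_coeff n d * (((1 - ?t) * (\<Sum>i<Suc d. ?t ^ i)) / (1 - ?t ^ Suc d))"
    unfolding Ftt_coeff_def power_Suc[of "1 - ?t" n] prods
    by (simp add: mult_ac del: sum.lessThan_Suc power_Suc)
  ultimately show ?thesis
    using nz[of "Suc d"] by simp
qed

text \<open>\<open>P\<close> and \<open>Q\<close> are determined by the two rational functions, as
  \<open>to_fract\<close> is injective; passing to them makes setting x_(n+1) = 0 a genuine
  substitution.\<close>

theorem corollary4p1:
  fixes f :: "nat \<Rightarrow> complex poly" and lam :: "nat list" and n :: nat
  assumes "f 0 = 1"
    and "\<And>k. k \<ge> 1 \<Longrightarrow> poly (f k) 0 = 0"
    and "is_partition lam"
    and "n \<ge> length lam"
  shows "\<exists>P Q. symmetric_mpol n P \<and> Ftt f lam n = to_fract P \<and>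
               symmetric_mpol (Suc n) Q \<and> Ftt f lam (Suc n) = to_fract Q \<and>
               P = msubst_zero (Suc n) Q"
proof -
  obtain P Q where P: "Ftt f lam n = to_fract P" and Q: "Ftt f lam (Suc n) = to_fract Q"
    using Ftt_polynomial by metis
  let ?s = "X(Suc n := 0)" and ?g = "\<lambda>i. f (part lam i)"
  \<comment> \<open>Positive parts make the polynomials vanish at 0 in the first l positions; past
    them the padding 0 of \<open>part\<close> selects \<open>f 0 = 1\<close>.\<close>
  have pos: "part lam k \<ge> 1" if "1 \<le> k" "k \<le> length lam" for k
    using that assms(3) by (simp add: part_def is_partition_def Suc_leI)
  have "specializes ?s (hl_sum ?g (Suc n)) ((\<Sum>i<Suc n - length lam. to_fract tvar ^ i) * hl_sum ?g n)"
    using assms pos by (intro specializes_hl_sum_zero) (auto simp: part_def[of lam])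
  then have "specializes ?s (Ftt f lam (Suc n)) (Ftt_coeff (Suc n) (Suc n - length lam) *
      ((\<Sum>i<Suc n - length lam. to_fract tvar ^ i) * hl_sum ?g n))"
    by (rule specializes_Ftt)
  \<comment> \<open>By n \<ge> l the truncated difference Suc n - l equals Suc (n - l), so the
    coefficient identity absorbs the geometric sum.\<close>
  also have "Ftt_coeff (Suc n) (Suc n - length lam) *
      ((\<Sum>i<Suc n - length lam. to_fract tvar ^ i) * hl_sum ?g n) = Ftt f lam n"
    unfolding Suc_diff_le[OF assms(4)] mult.assoc[symmetric] Ftt_coeff_Suc Ftt_eq ..
  finally have "to_fract (msubst ?s Q) = to_fract P"
    unfolding P Q by (intro specializes_unique[OF specializes_to_fract])
  then have "P = msubst_zero (Suc n) Q"
    by (simp only: to_fract_eq_iff msubst_zero_def)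
  then show ?thesis
    using P Q symmetric_mpol_Ftt by blast
qed

end
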